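(* Any $L$-ball weighted least squares subdivision scheme stepwise reproduces the space $\Pi_1$ of bivariate polynomials of degree at most $1$, meaning that $$S^k_{T^k}\left(p|_{V^k}\right)=p|_{V^{k+1}},\qquad \forall k\ge 0,\ \forall p\in\Pi_1,$$ which implies that the subdivision process converges to $p$ when the initial data is $p|_{V^0}$.
   Context: Triangulations. $T^0=(V^0,E^0)$ is a triangulation in the plane with vertices $V^0=\{\mathbf v^0_1,\dots,\mathbf v^0_{N^0}\}\subset\mathbb R^2$ and edges $E^0\subset\{1,\dots,N^0\}^2$ ($(i,j)\in E^0$ means that $\mathbf v^0_i,\mathbf v^0_j$ are connected by an edge); faces are non-degenerate triangles and every vertex and edge belongs to a face. $T^{k+1}=(V^{k+1},E^{k+1})$ is obtained from $T^k$ by adding the mid-point of every edge and splitting every face into four similar faces; thus each $\mathbf v^{k+1}_\ell\in V^{k+1}$, $\ell=1,\dots,N^{k+1}$, is either a vertex or an edge mid-point of $T^k$. Scheme. Fix $L>\sup\{\|\mathbf v^0_i-\mathbf v^0_j\|:(i,j)\in E^0\}$ (Euclidean norm) and a weight function $W:[0,1)\to(0,1]$. For $k\ge0$, $\ell=1,\dots,N^{k+1}$, put $$\mathcal B^{k+1,\ell}=\{j\in\{1,\dots,N^k\}:\|\mathbf v^k_j-\mathbf v^{k+1}_\ell\|<2^{-k}L\},\qquad w^{k+1,\ell}_i=W\!\left(\frac{\|\mathbf v^{k+1}_\ell-\mathbf v^k_i\|}{2^{-k}L}\right),\ i\in\mathcal B^{k+1,\ell}.$$ Given data $\mathbf z^k=(z^k_j)_{j=1}^{N^k}$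 attached to $V^k$, the new datum $z^{k+1}_\ell$ is $\hat p(\mathbf v^{k+1}_\ell)$, where $\hat p\in\Pi_1$ minimizes $\sum_{i\in\mathcal B^{k+1,\ell}}w^{k+1,\ell}_i\,(p(\mathbf v^k_i)-z^k_i)^2$ over $p\in\Pi_1$. Explicitly, $$z^{k+1}_\ell=\sum_{i\in\mathcal B^{k+1,\ell}}\alpha^{k+1,\ell}_i z^k_i,\qquad \alpha^{k+1,\ell}_i=\frac{w^{k+1,\ell}_i\mu^{k+1,\ell}_i}{\sum_{j\in\mathcal B^{k+1,\ell}}w^{k+1,\ell}_j\mu^{k+1,\ell}_j},$$ $$\mu^{k+1,\ell}_i=\sum_{\substack{j_1,j_2\in\mathcal B^{k+1,\ell}\\ j_1<j_2}}w^{k+1,\ell}_{j_1}w^{k+1,\ell}_{j_2}\begin{vmatrix}1&1&1\\ \mathbf v^{k+1}_\ell&\mathbf v^k_{j_1}&\mathbf v^k_{j_2}\end{vmatrix}\begin{vmatrix}1&1&1\\ \mathbf v^k_i&\mathbf v^k_{j_1}&\mathbf v^k_{j_2}\end{vmatrix},$$ where points of $\mathbb R^2$ are written as columns. The linear map $\mathbf z^k\mapsto\mathbf z^{k+1}$, $\mathbb R^{N^k}\to\mathbb R^{N^{k+1}}$, is denoted $S^k_{T^k}$. For a function $p$ on $\mathbb R^2$, $p|_{V^k}=(p(\mathbf v^k_j))_{j=1}^{N^k}$. The subdivision process started at $\mathbf z^0$ converges to a continuous function $G:\mathbb R^2\to\mathbb R$ if $\lim_{k\to\infty}\sup_\ell|z^k_\ell-G(\mathbf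 v^k_\ell)|=0$. *)

theory Defs
  imports "HOL-Analysis.Analysis"
begin

section \<open>Triangulations in the plane\<close>

text \<open>
  Vertices are enumerated by \<open>{1..nverts T}\<close>; the values of \<open>vert T\<close> outside this range are
  irrelevant. Every edge occurs in both orientations. Each face is recorded by the set of the indices
  of its three vertices: the pair of vertices and edges alone would not say whether an empty
  triangle bounded by three edges is a face or a hole.
\<close>

record tri =
  nverts :: nat
  vert :: "nat \<Rightarrow> real^2"
  edges :: "(nat \<times> nat) set"
  faces :: "nat set set"

definition indices :: "tri \<Rightarrow> nat set" where
  "indices T = {1..nverts T}"

definition face_sides :: "nat set set \<Rightarrow> (nat \<times> nat) set" where
  "face_sides F = {(i, j). i \<noteq> j \<and> (\<exists>f\<in>F. i \<in> f \<and> j \<in> f)}"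

text \<open>
  The library notion \<^const>\<open>triangulation\<close> says that any two of the given simplices meet in a common
  (possibly empty) face. The edges are exactly the sides of the faces: sides of a face are edges,
  and every edge belongs to a face.
\<close>

definition plane_triangulation :: "tri \<Rightarrow> bool" where
  "plane_triangulation T \<longleftrightarrow>
     nverts T \<ge> 1 \<and>
     inj_on (vert T) (indices T) \<and>
     (\<forall>f\<in>faces T. f \<subseteq> indices T \<and> card f = 3 \<and> \<not> collinear (vert T ` f)) \<and>
     triangulation ((\<lambda>f. convex hull (vert T ` f)) ` faces T) \<and>
     (\<forall>i\<in>indices T. \<exists>f\<in>faces T. i \<in> f) \<and>
     edges T = face_sides (faces T)"

text \<open>
  The vertex sets of the four triangles into which a face is split. As \<open>midpoint a a = a\<close>, the
  first set consists, for each vertex \<open>v\<^sub>i\<close> of the face, of the triangle formed by \<open>v\<^sub>i\<close> and the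
  mid-points of the two sides at \<open>v\<^sub>i\<close>.
\<close>

definition split_face :: "(nat \<Rightarrow> real^2) \<Rightarrow> nat set \<Rightarrow> (real^2) set set" where
  "split_face v f =
     {{midpoint (v i) (v j) | j. j \<in> f} | i. i \<in> f} \<union>
     {{midpoint (v i) (v j) | i j. i \<in> f \<and> j \<in> f \<and> i \<noteq> j}}"

text \<open>No relation between the enumerations of the old and the new vertices is required.\<close>

definition midpoint_refinement :: "tri \<Rightarrow> tri \<Rightarrow> bool" where
  "midpoint_refinement T T' \<longleftrightarrow>
     inj_on (vert T') (indices T') \<and>
     vert T' ` indices T' =
       vert T ` indices T \<union> {midpoint (vert T i) (vert T j) | i j. (i, j) \<in> edges T} \<and>
     faces T' = {f'. f' \<subseteq> indices T' \<and> (\<exists>f\<in>faces T. vert T' ` f' \<in> split_face (vert T) f)} \<and>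
     edges T' = face_sides (faces T')"


section \<open>Ball weighted least squares subdivision\<close>

definition Pi1 :: "(real^2 \<Rightarrow> real) set" where
  "Pi1 = {p. \<exists>a b c. p = (\<lambda>x. a + b * x$1 + c * x$2)}"

definition ball_nodes :: "real \<Rightarrow> (nat \<Rightarrow> tri) \<Rightarrow> nat \<Rightarrow> nat \<Rightarrow> nat set" where
  "ball_nodes L T k l =
     {j \<in> indices (T k). norm (vert (T k) j - vert (T (Suc k)) l) < (1/2)^k * L}"

definition ball_weight ::
  "(real \<Rightarrow> real) \<Rightarrow> real \<Rightarrow> (nat \<Rightarrow> tri) \<Rightarrow> nat \<Rightarrow> nat \<Rightarrow> nat \<Rightarrow> real" where
  "ball_weight W L T k l i = W (norm (vert (T (Suc k)) l - vert (T k) i) / ((1/2)^k * L))"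

definition wls_functional ::
  "(real \<Rightarrow> real) \<Rightarrow> real \<Rightarrow> (nat \<Rightarrow> tri) \<Rightarrow> nat \<Rightarrow> (nat \<Rightarrow> real) \<Rightarrow> nat \<Rightarrow> (real^2 \<Rightarrow> real) \<Rightarrow> real" where
  "wls_functional W L T k z l p =
     (\<Sum>i\<in>ball_nodes L T k l. ball_weight W L T k l i * (p (vert (T k) i) - z i)\<^sup>2)"

text \<open>
  If \<open>L\<close> exceeds the lengths of all edges of \<open>T 0\<close>, the nodes include the vertices of a non-degenerate
  triangle, so that the minimizer exists and is unique.
\<close>

definition wls_fit ::
  "(real \<Rightarrow> real) \<Rightarrow> real \<Rightarrow> (nat \<Rightarrow> tri) \<Rightarrow> nat \<Rightarrow> (nat \<Rightarrow> real) \<Rightarrow> nat \<Rightarrow> (real^2 \<Rightarrow> real)" where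
  "wls_fit W L T k z l = (THE p. is_arg_min (wls_functional W L T k z l) (\<lambda>p. p \<in> Pi1) p)"

text \<open>
  Data attached to the vertices of \<open>T k\<close> are functions on \<open>indices (T k)\<close>, extended by
  \<^const>\<open>undefined\<close> outside.
\<close>

definition subdiv_step ::
  "(real \<Rightarrow> real) \<Rightarrow> real \<Rightarrow> (nat \<Rightarrow> tri) \<Rightarrow> nat \<Rightarrow> (nat \<Rightarrow> real) \<Rightarrow> (nat \<Rightarrow> real)" where
  "subdiv_step W L T k z =
     (\<lambda>l\<in>indices (T (Suc k)). wls_fit W L T k z l (vert (T (Suc k)) l))"

definition vertex_values :: "tri \<Rightarrow> (real^2 \<Rightarrow> real) \<Rightarrow> (nat \<Rightarrow> real)" where
  "vertex_values T p = (\<lambda>j\<in>indices T. p (vert T j))"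

primrec subdiv_process ::
  "(real \<Rightarrow> real) \<Rightarrow> real \<Rightarrow> (nat \<Rightarrow> tri) \<Rightarrow> (nat \<Rightarrow> real) \<Rightarrow> nat \<Rightarrow> (nat \<Rightarrow> real)" where
  "subdiv_process W L T z0 0 = z0"
| "subdiv_process W L T z0 (Suc k) = subdiv_step W L T k (subdiv_process W L T z0 k)"

definition converges_to :: "(nat \<Rightarrow> tri) \<Rightarrow> (nat \<Rightarrow> nat \<Rightarrow> real) \<Rightarrow> (real^2 \<Rightarrow> real) \<Rightarrow> bool" where
  "converges_to T z G \<longleftrightarrow>
     continuous_on UNIV G \<and>
     (\<lambda>k. SUP l\<in>indices (T k). \<bar>z k l - G (vert (T k) l)\<bar>) \<longlonglongrightarrow> 0"

end

(* The weighted least squares functional of the data p|V is nonnegative and vanishes at p, so any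
   other minimizer agrees with p at all nodes of the ball; an affine function vanishing at three
   non-collinear points is zero. It therefore suffices that each ball contains the vertices of a
   face. A new vertex is a (possibly degenerate) mid-point of two vertices of a face of T k, hence by
   convexity of balls it is as close to all three vertices of that face as these are to one another.
   Face diameters halve with each refinement, because the new faces are images of the old ones under
   homotheties with ratio 1/2 or -1/2. *)
theory Submission
  imports Defs
begin

section \<open>Affine functions of two variables\<close>

text \<open>A nonzero gradient \<open>(b, c)\<close> would confine the zero set to a line of
  direction \<open>(-c, b)\<close>, which cannot contain \<open>S\<close>. So \<open>d\<close> is
  constant, and one point of \<open>S\<close> settles its value.\<close>

lemma Pi1_vanish_noncollinear:
  assumes "d \<in> Pi1" and nc: "\<not> collinear S" and zero: "\<And>x. x \<in> S \<Longrightarrow> d x = 0"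
  shows "d = (\<lambda>x. 0)"
proof -
  obtain a b c where d: "d = (\<lambda>x. a + b * x$1 + c * x$2)"
    using assms(1) by (auto simp: Pi1_def)
  have bc: "b = 0 \<and> c = 0"
  proof (rule ccontr)
    assume "\<not> (b = 0 \<and> c = 0)"
    then have n: "b\<^sup>2 + c\<^sup>2 \<noteq> 0"
      by (simp add: sum_power2_eq_zero_iff)
    have "\<exists>t. x - y = t *\<^sub>R (vector [-c, b] :: real^2)" if "x \<in> S" "y \<in> S" for x y
    proof -
      define e where "e = x - y"
      have orth: "b * e$1 + c * e$2 = 0"
        using zero[OF that(1)] zero[OF that(2)] by (simp add: d e_def algebra_simps)
      \<comment> \<open>The coefficient of the orthogonal projection of \<open>e\<close> onto
        \<open>(-c, b)\<close>; since \<open>e\<close> is orthogonal to \<open>(b, c)\<close>, the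
        projection is \<open>e\<close> itself.\<close>
      define t where "t = (b * e$2 - c * e$1) / (b\<^sup>2 + c\<^sup>2)"
      have "b * e$2 * c = - (b * b * e$1) + b * (b * e$1 + c * e$2)"
        "b * e$1 * c = - (c * c * e$2) + c * (b * e$1 + c * e$2)"
        by (simp_all add: algebra_simps)
      then have "e$1 = t * -c" "e$2 = t * b"
        using n orth by (simp_all add: t_def field_simps power2_eq_square)
      then have "e = t *\<^sub>R (vector [-c, b] :: real^2)"
        by (simp add: vec_eq_iff forall_2)
      then show ?thesis
        unfolding e_def by blast
    qed
    then show False
      using nc unfolding collinear_def by blast
  qed
  \<comment> \<open>The empty set is collinear, so \<open>S\<close> has a point.\<close>
  obtain x where "x \<in> S"
    using nc by fastforce
  then show ?thesis
    using zero[of x] bc by (simp add: d)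
qed

lemma Pi1_diff: "p \<in> Pi1 \<Longrightarrow> q \<in> Pi1 \<Longrightarrow> (\<lambda>x. p x - q x) \<in> Pi1"
proof -
  assume "p \<in> Pi1" "q \<in> Pi1"
  then obtain a b c a' b' c' where
    "p = (\<lambda>x. a + b * x$1 + c * x$2)" "q = (\<lambda>x. a' + b' * x$1 + c' * x$2)"
    by (auto simp: Pi1_def)
  then have "(\<lambda>x. p x - q x) = (\<lambda>x. (a - a') + (b - b') * x$1 + (c - c') * x$2)"
    by (auto simp: algebra_simps)
  then show ?thesis
    unfolding Pi1_def by blast
qed

lemma continuous_on_Pi1: "p \<in> Pi1 \<Longrightarrow> continuous_on A p"
  by (auto simp: Pi1_def intro!: continuous_intros)

section \<open>Homotheties and the splitting of a face\<close>

text \<open>Differences do not see the translation \<open>a\<close>, so the direction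
  \<open>u\<close> of the image also serves for \<open>S\<close>, with coefficients divided by
  \<open>c\<close>.\<close>

lemma collinear_homothety_imp:
  fixes a :: "'a::real_vector"
  assumes "collinear ((\<lambda>x. a + c *\<^sub>R x) ` S)" and c: "c \<noteq> 0"
  shows "collinear S"
proof -
  obtain u where u: "\<And>x y. x \<in> S \<Longrightarrow> y \<in> S \<Longrightarrow> \<exists>t. c *\<^sub>R x - c *\<^sub>R y = t *\<^sub>R u"
    using assms(1) unfolding collinear_def by force
  have "\<exists>t. x - y = t *\<^sub>R u" if xy: "x \<in> S" "y \<in> S" for x y
  proof -
    obtain t where "c *\<^sub>R x - c *\<^sub>R y = t *\<^sub>R u"
      using u[OF xy] by blast
    then have "c *\<^sub>R (x - y) = c *\<^sub>R ((t / c) *\<^sub>R u)"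
      using c by (simp add: scaleR_diff_right)
    then show ?thesis
      using c scaleR_left_imp_eq by blast
  qed
  then show ?thesis
    unfolding collinear_def by blast
qed

text \<open>Sets of at most two points are collinear. Thus non-collinearity alone keeps the corners
  of a face distinct.\<close>

lemma noncollinear_card3_imp_inj_on:
  assumes "card f = 3" "\<not> collinear (v ` f)"
  shows "inj_on v f"
proof -
  have fin: "finite f"
    using assms(1) card.infinite by fastforce
  then have "\<not> card (v ` f) \<le> 2"
    using assms(2) collinear_small[of "v ` f"] by auto
  then have "card (v ` f) = card f"
    using card_image_le[OF fin, of v] assms(1) by linarith
  then show ?thesis
    using fin eq_card_imp_inj_on by blast
qed

text \<open>A corner triangle is the face shrunk by 1/2 towards that corner; the inner triangle is
  the face under ratio -1/2 about its centroid. The common form lets \<open>mesh_refinement\<close>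
  treat all four alike.\<close>

lemma split_face_homothety:
  assumes "S \<in> split_face v f" "card f = 3"
  obtains a c where "\<bar>c\<bar> = 1/2" "S = (\<lambda>x. a + c *\<^sub>R x) ` v ` f"
proof -
  consider i where "i \<in> f" "S = {midpoint (v i) (v j) | j. j \<in> f}"
    | "S = {midpoint (v i) (v j) | i j. i \<in> f \<and> j \<in> f \<and> i \<noteq> j}"
    using assms(1) unfolding split_face_def by blast
  then show thesis
  proof cases
    case 1
    then have "S = (\<lambda>x. (1/2) *\<^sub>R v i + (1/2) *\<^sub>R x) ` v ` f"
      by (auto simp: midpoint_def scaleR_add_right)
    then show thesis
      by (intro that[of "1/2" "(1/2) *\<^sub>R v i"]) simp_all
  next
    case 2
    obtain x y z where f: "f = {x, y, z}" "x \<noteq> y" "x \<noteq> z" "y \<noteq> z"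
      using assms(2) by (auto simp: card_3_iff)
    \<comment> \<open>The mid-point of the side opposite a corner \<open>u\<close> is half of the
      sum of the three corners minus half of \<open>u\<close>.\<close>
    let ?g = "\<lambda>u. (1/2) *\<^sub>R (v x + v y + v z) + (-1/2) *\<^sub>R u"
    have "S = {midpoint (v y) (v z), midpoint (v x) (v z), midpoint (v x) (v y)}"
      using f by (auto simp: 2 midpoint_sym)
    moreover have "?g (v x) = midpoint (v y) (v z)" "?g (v y) = midpoint (v x) (v z)"
      "?g (v z) = midpoint (v x) (v y)"
      by (simp_all add: midpoint_def vec_eq_iff algebra_simps)
    ultimately have "S = ?g ` v ` f"
      by (simp add: f)
    then show thesis
      by (intro that[of "-1/2" "(1/2) *\<^sub>R (v x + v y + v z)"]) simp_all
  qed
qed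

section \<open>Face diameters under refinement\<close>

text \<open>The part of being a triangulation with face diameters below \<open>r\<close> that refinement
  visibly preserves.\<close>

definition mesh :: "real \<Rightarrow> tri \<Rightarrow> bool" where
  "mesh r T \<longleftrightarrow>
     indices T \<noteq> {} \<and>
     (\<forall>f\<in>faces T. f \<subseteq> indices T \<and> card f = 3 \<and> \<not> collinear (vert T ` f) \<and>
        (\<forall>i\<in>f. \<forall>j\<in>f. dist (vert T i) (vert T j) < r)) \<and>
     (\<forall>i\<in>indices T. \<exists>f\<in>faces T. i \<in> f) \<and>
     edges T = face_sides (faces T)"

lemma mesh_face:
  assumes "mesh r T" "f \<in> faces T"
  shows "f \<subseteq> indices T" "card f = 3" "\<not> collinear (vert T ` f)"
    "\<And>i j. i \<in> f \<Longrightarrow> j \<in> f \<Longrightarrow> dist (vert T i) (vert T j) < r"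
  using assms by (auto simp: mesh_def)

lemma mesh_vertex:
  assumes "mesh r T" "i \<in> indices T"
  obtains f where "f \<in> faces T" "i \<in> f"
  using assms unfolding mesh_def by meson

lemma mesh_edge_iff:
  assumes "mesh r T"
  shows "(i, j) \<in> edges T \<longleftrightarrow> i \<noteq> j \<and> (\<exists>f\<in>faces T. i \<in> f \<and> j \<in> f)"
proof -
  have "edges T = face_sides (faces T)"
    using assms by (simp only: mesh_def)
  then show ?thesis
    by (simp add: face_sides_def)
qed

text \<open>An old vertex is the mid-point of itself with itself (\<open>i = j\<close>) and lies in
  some face, so old vertices and edge mid-points need no separate treatment later.\<close>

lemma refinement_vertex_midpoint:
  assumes "mesh r T" "midpoint_refinement T T'" "l \<in> indices T'"
  obtains f i j where "f \<in> faces T" "i \<in> f" "j \<in> f" "vert T' l = midpoint (vert T i) (vert T j)"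
proof -
  have "vert T' l \<in> vert T ` indices T \<union> {midpoint (vert T i) (vert T j) | i j. (i, j) \<in> edges T}"
    using assms(2,3) unfolding midpoint_refinement_def by blast
  then consider i where "i \<in> indices T" "vert T' l = vert T i"
    | i j where "(i, j) \<in> edges T" "vert T' l = midpoint (vert T i) (vert T j)"
    by blast
  then show thesis
  proof cases
    case 1
    obtain f where "f \<in> faces T" "i \<in> f"
      using mesh_vertex[OF assms(1) 1(1)] .
    then show thesis
      using 1 that[of f i i] by simp
  next
    case 2
    then obtain f where "f \<in> faces T" "i \<in> f" "j \<in> f"
      using mesh_edge_iff[OF assms(1)] by blast
    then show thesis
      using 2 that by blast
  qed
qed

text \<open>Ensures that the corner triangles of a split face are realized by indices of
  \<open>T'\<close>.\<close>

lemma refinement_contains_midpoint: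
  assumes "mesh r T" "midpoint_refinement T T'" "f \<in> faces T" "i \<in> f" "j \<in> f"
  shows "midpoint (vert T i) (vert T j) \<in> vert T' ` indices T'"
proof -
  have V: "vert T' ` indices T' =
       vert T ` indices T \<union> {midpoint (vert T i) (vert T j) | i j. (i, j) \<in> edges T}"
    using assms(2) by (simp add: midpoint_refinement_def)
  show ?thesis
  proof (cases "i = j")
    case True
    then show ?thesis
      using mesh_face(1)[OF assms(1,3)] assms(4) V by auto
  next
    case False
    then have "(i, j) \<in> edges T"
      using mesh_edge_iff[OF assms(1)] assms(3-5) by blast
    then show ?thesis
      using V by blast
  qed
qed

lemma mesh_refinement:
  assumes M: "mesh r T" and R: "midpoint_refinement T T'"
  shows "mesh (r / 2) T'"
  unfolding mesh_def
proof (intro conjI ballI)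
  have "indices T \<noteq> {}"
    using M unfolding mesh_def by meson
  moreover have "vert T ` indices T \<subseteq> vert T' ` indices T'"
    using R unfolding midpoint_refinement_def by blast
  ultimately show "indices T' \<noteq> {}"
    by blast
  show "edges T' = face_sides (faces T')"
    using R by (simp add: midpoint_refinement_def)
  have inj: "inj_on (vert T') (indices T')"
    using R by (simp add: midpoint_refinement_def)
  fix f' assume "f' \<in> faces T'"
  then obtain f where f': "f' \<subseteq> indices T'" and f: "f \<in> faces T"
    and S: "vert T' ` f' \<in> split_face (vert T) f"
    using R unfolding midpoint_refinement_def by auto
  note F = mesh_face[OF M f]
  obtain a c where c: "\<bar>c\<bar> = 1/2" and img: "vert T' ` f' = (\<lambda>x. a + c *\<^sub>R x) ` vert T ` f"
    using split_face_homothety[OF S F(2)] .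
  have c0: "c \<noteq> 0"
    using c by auto
  show "f' \<subseteq> indices T'"
    by (rule f')
  \<comment> \<open>Indices are counted through their points: \<open>vert T'\<close> is injective on
    \<open>f'\<close>, the homothety is injective, and \<open>vert T\<close> is injective on
    \<open>f\<close>.\<close>
  have "card f' = card (vert T' ` f')"
    using inj_on_subset[OF inj f'] by (simp add: card_image)
  also have "\<dots> = card (vert T ` f)"
    unfolding img using c0 by (intro card_image) (simp add: inj_on_def)
  also have "\<dots> = 3"
    using noncollinear_card3_imp_inj_on[OF F(2,3)] F(2) by (simp add: card_image)
  finally show "card f' = 3" .
  show "\<not> collinear (vert T' ` f')"
    using F(3) collinear_homothety_imp[OF _ c0] unfolding img by blast
  fix i j assume "i \<in> f'" "j \<in> f'"
  then have "vert T' i \<in> (\<lambda>x. a + c *\<^sub>R x) ` vert T ` f"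
    "vert T' j \<in> (\<lambda>x. a + c *\<^sub>R x) ` vert T ` f"
    unfolding img[symmetric] by simp_all
  then obtain i' j' where ij: "i' \<in> f" "j' \<in> f"
    "vert T' i = a + c *\<^sub>R vert T i'" "vert T' j = a + c *\<^sub>R vert T j'"
    by blast
  then have "dist (vert T' i) (vert T' j) = \<bar>c\<bar> * dist (vert T i') (vert T j')"
    by (simp add: dist_norm norm_scaleR[symmetric] scaleR_diff_right del: norm_scaleR)
  then show "dist (vert T' i) (vert T' j) < r / 2"
    using F(4)[OF ij(1,2)] c by simp
next
  fix l assume l: "l \<in> indices T'"
  obtain f i j where f: "f \<in> faces T" "i \<in> f" "j \<in> f"
    "vert T' l = midpoint (vert T i) (vert T j)"
    using refinement_vertex_midpoint[OF M R l] .
  \<comment> \<open>The corner triangle at \<open>vert T i\<close> has \<open>vert T' l\<close> as a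
    vertex, also when \<open>i = j\<close>.\<close>
  define S where "S = {midpoint (vert T i) (vert T m) | m. m \<in> f}"
  \<comment> \<open>A new face is recognized by its image, so the full preimage of \<open>S\<close>
    is taken; its image is all of \<open>S\<close> because every point of \<open>S\<close> is a new
    vertex.\<close>
  define f' where "f' = {m \<in> indices T'. vert T' m \<in> S}"
  have "S \<subseteq> vert T' ` indices T'"
    using refinement_contains_midpoint[OF M R f(1,2)] by (auto simp: S_def)
  then have "vert T' ` f' = S"
    by (auto simp: f'_def)
  moreover have "S \<in> split_face (vert T) f"
    using f(2) by (auto simp: split_face_def S_def)
  ultimately have "f' \<in> faces T'"
    using R f(1) by (auto simp: midpoint_refinement_def f'_def)
  moreover have "l \<in> f'"
    using l f by (auto simp: f'_def S_def)
  ultimately show "\<exists>f'\<in>faces T'. l \<in> f'"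
    by blast
qed

lemma mesh_plane_triangulation:
  assumes P: "plane_triangulation T"
    and L: "(SUP (i, j)\<in>edges T. norm (vert T i - vert T j)) < L"
  shows "mesh L T"
proof -
  have E: "edges T = face_sides (faces T)"
    and F: "\<And>f. f \<in> faces T \<Longrightarrow> f \<subseteq> indices T \<and> card f = 3 \<and> \<not> collinear (vert T ` f)"
    using P by (auto simp: plane_triangulation_def)
  have "edges T \<subseteq> indices T \<times> indices T"
    using F by (auto simp: E face_sides_def)
  \<comment> \<open>Finiteness bounds the edge lengths above, so that their real supremum really
    dominates each of them.\<close>
  then have fin: "finite (edges T)"
    by (rule finite_subset) (simp add: indices_def)
  have edge: "dist (vert T i) (vert T j) < L" if "(i, j) \<in> edges T" for i j
  proof -
    have "norm (vert T i - vert T j) \<le> (SUP (i, j)\<in>edges T. norm (vert T i - vert T j))"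
      using cSUP_upper[OF that, of "\<lambda>(i, j). norm (vert T i - vert T j)"] fin by simp
    then show ?thesis
      using L by (simp add: dist_norm)
  qed
  have "dist (vert T i) (vert T j) < L" if f: "f \<in> faces T" and ij: "i \<in> f" "j \<in> f" for f i j
  proof (cases "i = j")
    case True
    \<comment> \<open>Here the claim is \<open>0 < L\<close>, which follows because \<open>L\<close>
      exceeds the length of an edge at \<open>i\<close>.\<close>
    have "f \<noteq> {i}"
      using F[OF f] by auto
    then obtain m where "m \<in> f" "m \<noteq> i"
      using ij by blast
    then have "dist (vert T i) (vert T m) < L"
      using f ij by (intro edge) (auto simp: E face_sides_def)
    then have "0 < L"
      by (rule le_less_trans[OF zero_le_dist])
    then show ?thesis
      using True by simp
  next
    case False
    then show ?thesis
      using f ij by (intro edge) (auto simp: E face_sides_def)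
  qed
  then show ?thesis
    using P F E by (auto simp: mesh_def plane_triangulation_def indices_def)
qed

section \<open>Least squares fits on balls\<close>

lemma ball_nodes_face:
  assumes M: "mesh ((1/2)^k * L) (T k)" and R: "midpoint_refinement (T k) (T (Suc k))"
    and l: "l \<in> indices (T (Suc k))"
  obtains f where "f \<in> faces (T k)" "f \<subseteq> ball_nodes L T k l"
proof -
  obtain f i j where f: "f \<in> faces (T k)" "i \<in> f" "j \<in> f"
    and v: "vert (T (Suc k)) l = midpoint (vert (T k) i) (vert (T k) j)"
    using refinement_vertex_midpoint[OF M R l] .
  note F = mesh_face[OF M f(1)]
  have "norm (vert (T k) m - vert (T (Suc k)) l) < (1/2)^k * L" if m: "m \<in> f" for m
  proof -
    \<comment> \<open>Centring the ball at the corner \<open>m\<close> instead of the new vertex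
      puts both end points \<open>i\<close> and \<open>j\<close> inside it, so convexity
      applies.\<close>
    let ?B = "ball (vert (T k) m) ((1/2)^k * L)"
    have "vert (T k) i \<in> ?B" "vert (T k) j \<in> ?B"
      using F(4)[OF m f(2)] F(4)[OF m f(3)] by (simp_all only: mem_ball)
    then have "closed_segment (vert (T k) i) (vert (T k) j) \<subseteq> ?B"
      by (rule closed_segment_subset[OF _ _ convex_ball])
    then have "vert (T (Suc k)) l \<in> ?B"
      unfolding v using midpoint_in_closed_segment by blast
    then show ?thesis
      by (simp add: dist_norm)
  qed
  then have "f \<subseteq> ball_nodes L T k l"
    using F(1) by (auto simp: ball_nodes_def)
  then show thesis
    using f(1) that by blast
qed

lemma wls_fit_vertex_values:
  assumes M: "mesh ((1/2)^k * L) (T k)" and R: "midpoint_refinement (T k) (T (Suc k))"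
    and W: "\<And>t. t \<in> {0..<1} \<Longrightarrow> W t \<in> {0<..1}"
    and l: "l \<in> indices (T (Suc k))" and p: "p \<in> Pi1"
  shows "wls_fit W L T k (vertex_values (T k) p) l = p"
proof -
  let ?B = "ball_nodes L T k l" and ?w = "ball_weight W L T k l"
  let ?J = "wls_functional W L T k (vertex_values (T k) p) l"
  have fin: "finite ?B"
    by (simp add: ball_nodes_def indices_def)
  have w: "?w i > 0" if "i \<in> ?B" for i
  proof -
    \<comment> \<open>The node itself witnesses that the radius is positive, so the argument of
      \<open>W\<close> lies in \<open>[0,1)\<close>.\<close>
    have n: "norm (vert (T (Suc k)) l - vert (T k) i) < (1/2)^k * L"
      using that by (simp add: ball_nodes_def norm_minus_commute)
    then have "(1/2)^k * L > 0"
      by (rule le_less_trans[OF norm_ge_zero])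
    then have "norm (vert (T (Suc k)) l - vert (T k) i) / ((1/2)^k * L) \<in> {0..<1}"
      using n by (simp only: atLeastLessThan_iff divide_less_eq_1_pos divide_nonneg_pos norm_ge_zero)
    then show ?thesis
      unfolding ball_weight_def using W by (meson greaterThanAtMost_iff)
  qed
  have J: "?J q = (\<Sum>i\<in>?B. ?w i * (q (vert (T k) i) - p (vert (T k) i))\<^sup>2)" for q
    unfolding wls_functional_def vertex_values_def
    by (intro sum.cong refl) (simp add: ball_nodes_def)
  have nonneg: "?w i * (q (vert (T k) i) - p (vert (T k) i))\<^sup>2 \<ge> 0" if "i \<in> ?B" for i q
    using w[OF that] by simp
  obtain f where f: "f \<in> faces (T k)" "f \<subseteq> ?B"
    using ball_nodes_face[OF M R l] .
  show ?thesis
    unfolding wls_fit_def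
  proof (rule the_equality)
    have "?J p = 0" "\<And>q. ?J q \<ge> 0"
      unfolding J using nonneg by (simp, intro sum_nonneg)
    then show "is_arg_min ?J (\<lambda>p. p \<in> Pi1) p"
      using p by (simp add: is_arg_min_def not_less)
  next
    fix q assume "is_arg_min ?J (\<lambda>p. p \<in> Pi1) q"
    then have q: "q \<in> Pi1" and "?J q \<le> ?J p"
      using p by (auto simp: is_arg_min_def not_less)
    then have "?J q \<le> 0"
      by (simp add: J)
    moreover have "?J q \<ge> 0"
      unfolding J using nonneg by (intro sum_nonneg)
    ultimately have "\<forall>i\<in>?B. ?w i * (q (vert (T k) i) - p (vert (T k) i))\<^sup>2 = 0"
      unfolding J using sum_nonneg_eq_0_iff[OF fin] nonneg by (metis (no_types, lifting) order_antisym)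
    \<comment> \<open>The corners of \<open>f\<close> are nodes, and their positive weights
      cancel.\<close>
    then have "q x - p x = 0" if "x \<in> vert (T k) ` f" for x
      using that w f(2) by fastforce
    then have "(\<lambda>x. q x - p x) = (\<lambda>x. 0)"
      by (rule Pi1_vanish_noncollinear[OF Pi1_diff[OF q p] mesh_face(3)[OF M f(1)]])
    then show "q = p"
      by (simp add: fun_eq_iff)
  qed
qed

theorem proposition4p1:
  fixes T :: "nat \<Rightarrow> tri" and L :: real and W :: "real \<Rightarrow> real"
  assumes "plane_triangulation (T 0)"
    and "\<And>k. midpoint_refinement (T k) (T (Suc k))"
    and "(SUP (i, j)\<in>edges (T 0). norm (vert (T 0) i - vert (T 0) j)) < L"
    and "\<And>t. t \<in> {0..<1} \<Longrightarrow> W t \<in> {0<..1}"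
  shows "(\<forall>k. \<forall>p\<in>Pi1. subdiv_step W L T k (vertex_values (T k) p) = vertex_values (T (Suc k)) p)
       \<and> (\<forall>p\<in>Pi1. converges_to T (subdiv_process W L T (vertex_values (T 0) p)) p)"
proof -
  \<comment> \<open>The diameter bound at level \<open>k\<close> is exactly the radius of the balls
    there.\<close>
  have M: "mesh ((1/2)^k * L) (T k)" for k
  proof (induction k)
    case 0
    show ?case
      using mesh_plane_triangulation[OF assms(1,3)] by simp
  next
    case (Suc k)
    show ?case
      using mesh_refinement[OF Suc assms(2)] by simp
  qed
  have step: "subdiv_step W L T k (vertex_values (T k) p) = vertex_values (T (Suc k)) p"
    if p: "p \<in> Pi1" for k p
  proof -
    have "wls_fit W L T k (vertex_values (T k) p) l = p" if "l \<in> indices (T (Suc k))" for l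
      using M assms(2,4) that p by (rule wls_fit_vertex_values)
    then show ?thesis
      unfolding subdiv_step_def vertex_values_def[of "T (Suc k)"] by (intro restrict_ext) simp
  qed
  have "converges_to T (subdiv_process W L T (vertex_values (T 0) p)) p" if p: "p \<in> Pi1" for p
  proof -
    have process: "subdiv_process W L T (vertex_values (T 0) p) k = vertex_values (T k) p" for k
      by (induction k) (simp_all add: step p)
    have "(SUP l\<in>indices (T k). \<bar>vertex_values (T k) p l - p (vert (T k) l)\<bar>) = 0" for k
    proof -
      \<comment> \<open>The supremum of the constant 0 is 0 only over a nonempty index set; the real
        supremum of the empty set has no known value.\<close>
      have "indices (T k) \<noteq> {}"
        using M[of k] unfolding mesh_def by meson
      then show ?thesis
        by (simp add: vertex_values_def cong: SUP_cong)
    qed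
    then show ?thesis
      using continuous_on_Pi1[OF p] by (simp add: converges_to_def process)
  qed
  then show ?thesis
    using step by blast
qed

end
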